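(* Let $d$ be a positive integer and let $p=p(n)\in[0,1]$. The following holds asymptotically almost surely. (i) If $n^{-d}\ll p\ll n^{-2d/3}$, then $$F([n]^d_p)=(1+o(1))\,n^dp.$$ (ii) If $n^{-d}\ll p\le 2n^{-2d/3}$, then $$\left(\tfrac13+o(1)\right)n^dp\ \le\ F([n]^d_p)\ \le\ (1+o(1))\,n^dp.$$
   Context: For positive integers $d,n$, $[n]^d$ denotes the set of all vectors $(a_1,\dots,a_d)$ of integers with $0\le a_i\le n-1$. A subset $S\subseteq[n]^d$ is a Sidon set if all sums of two (not necessarily distinct) vectors of $S$ are distinct, i.e. whenever $a+b=c+e$ with $a,b,c,e\in S$ one has $\{a,b\}=\{c,e\}$. $[n]^d_p$ denotes the random subset of $[n]^d$ obtained by choosing each element independently with probability $p=p(n)$, and $F([n]^d_p)$ is the maximum size of a Sidon set contained in $[n]^d_p$. The integer $d$ is fixed and asymptotics are as $n\to\infty$; $f\ll g$ means $f/g\to0$. "Asymptotically almost surely" (a.a.s.) means with probability tending to $1$ as $n\to\infty$; bounds with $o(1)$ terms mean that for every $\eta>0$ the corresponding bounds with $o(1)$ replaced by $-\eta$ (lower bounds) or $+\eta$ (upper bounds) hold with probability tending to $1$. *)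

theory Defs
  imports "HOL-Probability.Probability"
begin

text \<open>The box written \<open>[n]\<^sup>d\<close> in the literature, with \<open>d = CARD('d)\<close>; coordinates start at 0.\<close>

definition grid :: "nat \<Rightarrow> (int ^ 'd) set" where
  "grid n = {a. \<forall>i. 0 \<le> a $ i \<and> a $ i \<le> int n - 1}"

definition sidon :: "'a::ab_semigroup_add set \<Rightarrow> bool" where
  "sidon S \<longleftrightarrow> (\<forall>a\<in>S. \<forall>b\<in>S. \<forall>c\<in>S. \<forall>e\<in>S. a + b = c + e \<longrightarrow> {a, b} = {c, e})"

text \<open>Only meaningful for finite \<open>S\<close>, where the maximum is over a finite set containing 0.\<close>

definition max_sidon :: "'a::ab_semigroup_add set \<Rightarrow> nat" where
  "max_sidon S = Max {card T | T. T \<subseteq> S \<and> sidon T}"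

text \<open>Independent Bernoulli indicators on the finite set \<open>A\<close>; outside \<open>A\<close> the indicator is
  constantly \<open>False\<close>, so the result is a subset of \<open>A\<close>.\<close>

definition random_subset :: "'a set \<Rightarrow> real \<Rightarrow> 'a set pmf" where
  "random_subset A q = map_pmf (\<lambda>f. {x. f x}) (Pi_pmf A False (\<lambda>_. bernoulli_pmf q))"

definition aas :: "(nat \<Rightarrow> 'a pmf) \<Rightarrow> (nat \<Rightarrow> 'a \<Rightarrow> bool) \<Rightarrow> bool" where
  "aas M P \<longleftrightarrow> (\<lambda>n. measure_pmf.prob (M n) {x. P n x}) \<longlonglongrightarrow> 1"

lemma grid_bij: "bij_betw vec_nth (grid n :: (int ^ 'd) set) (UNIV \<rightarrow>\<^sub>E {0..<int n})"
  by (rule bij_betw_byWitness[where f' = vec_lambda]) (auto simp: grid_def)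

lemma finite_grid: "finite (grid n)"
  using bij_betw_finite[OF grid_bij] by (simp add: finite_PiE)

lemma card_grid: "card (grid n :: (int ^ 'd) set) = n ^ CARD('d)"
  using bij_betw_same_card[OF grid_bij] by (simp add: card_PiE)

end

theory Submission
  imports Defs
begin

text \<open>
  Write \<open>N = n\<^sup>d\<close> for the number of grid points. The upper bound is \<open>F \<le> |S|\<close> together with the
  concentration of \<open>|S|\<close> around \<open>Np\<close>. The lower bound is the deletion method. The group
  \<open>\<int>\<^sup>d\<close> has no \<open>2\<close>-torsion, so a violation of the Sidon property of \<open>S\<close> spans either a
  ``parallelogram'', four distinct points with \<open>a + b = c + e\<close>, or a ``progression'', three distinct
  points with \<open>a + a = c + e\<close>. Removing one point from each of these that lies in \<open>S\<close> gives
  \<open>F \<ge> |S| - X - Y\<close>, where \<open>X\<close> and \<open>Y\<close> count the parallelograms and the progressions inside \<open>S\<close>.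

  Progressions are negligible: there are at most \<open>N\<^sup>2\<close> of them, so \<open>Y\<close> has mean at most \<open>N\<^sup>2p\<^sup>3\<close>,
  which is at most \<open>8\<close> when \<open>p \<le> 2N\<^bsup>-2/3\<^esup>\<close>, whereas \<open>Np \<rightarrow> \<infinity>\<close>.

  For \<open>X\<close> the constant matters. Among the triples \<open>(a, b, c)\<close> of grid points, the proportion with
  \<open>a + b - c\<close> in the grid is at most \<open>2/3 + o(1)\<close>, the value in dimension one, and every
  parallelogram arises from eight such triples. Hence \<open>X\<close> has mean at most
  \<open>(1 + o(1)) N\<^sup>3p\<^sup>4 / 12 = (1 + o(1)) Np \<cdot> N\<^sup>2p\<^sup>3 / 12\<close>. For \<open>N\<^sup>2p\<^sup>3 \<le> 8\<close> this is at most
  \<open>(2/3 + o(1)) Np\<close>, which leaves the third in the second claim; for \<open>p \<lless> N\<^bsup>-2/3\<^esup>\<close> it is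
  \<open>o(Np)\<close>, which gives the first claim.

  As the mean of \<open>X\<close> may be of the same order as \<open>|S|\<close>, Markov's inequality is too weak for it and the
  second moment is used. A parallelogram is determined, up to boundedly many choices, by any three of
  its points, so \<open>O(N\<^bsup>k-1\<^esup>)\<close> of them have exactly \<open>k\<close> points outside a given one
  (\<open>card_parallelograms_overlapping_le\<close>). For \<open>N\<^sup>2p\<^sup>3 \<le> 8\<close> and
  \<open>Np \<ge> 1\<close> this makes the variance of \<open>X\<close> at most a constant times \<open>Np\<close>. Chebyshev's inequality
  for \<open>|S|\<close> and \<open>X\<close> and Markov's for \<open>Y\<close> then bound the failure probabilities by \<open>O(1 / Np)\<close>
  (\<open>prob_max_sidon_deviates_le\<close>).
\<close>

section \<open>Counting members of a family inside a random set\<close>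

lemma finite_set_random_subset:
  assumes "finite A"
  shows "finite (set_pmf (random_subset A q))"
proof -
  have "set_pmf (Pi_pmf A False (\<lambda>_. bernoulli_pmf q)) \<subseteq> PiE_dflt A False (\<lambda>_. UNIV)"
    using set_Pi_pmf_subset'[OF assms] by (fastforce simp: PiE_dflt_def)
  moreover have "finite (PiE_dflt A False (\<lambda>_. UNIV :: bool set))"
    using assms by (intro finite_PiE_dflt) auto
  ultimately show ?thesis
    by (auto simp: random_subset_def intro: finite_subset)
qed

lemma set_random_subset:
  assumes "finite A" "S \<in> set_pmf (random_subset A q)"
  shows "S \<subseteq> A"
  using assms set_Pi_pmf_subset[OF assms(1)] by (fastforce simp: random_subset_def)

lemma prob_contains_random_subset:
  assumes "finite A" "Q \<subseteq> A" "0 \<le> q" "q \<le> 1"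
  shows "measure_pmf.prob (random_subset A q) {S. Q \<subseteq> S} = q ^ card Q"
proof -
  define B where "B = (\<lambda>x. if x \<in> Q then {True} else UNIV)"
  have eq: "(\<lambda>f. {x. f x}) -` {S. Q \<subseteq> S} = Pi A B"
    using assms(2) by (auto simp: B_def Pi_def)
  have "measure_pmf.prob (random_subset A q) {S. Q \<subseteq> S}
      = (\<Prod>x\<in>A. measure_pmf.prob (bernoulli_pmf q) (B x))"
    unfolding random_subset_def measure_map_pmf eq by (rule measure_Pi_pmf_Pi[OF assms(1)])
  also have "\<dots> = (\<Prod>x\<in>A. if x \<in> Q then q else 1)"
    using assms(3,4) by (intro prod.cong) (auto simp: B_def measure_pmf_single)
  also have "\<dots> = q ^ card Q"
    using assms(1,2) by (simp add: prod.If_cases Int_absorb1)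
  finally show ?thesis .
qed

definition copies :: "'a set set \<Rightarrow> 'a set \<Rightarrow> real" where
  "copies H S = real (card {Q \<in> H. Q \<subseteq> S})"

lemma copies_eq_sum:
  assumes "finite H"
  shows "copies H S = (\<Sum>Q\<in>H. indicator {S. Q \<subseteq> S} S)"
proof -
  have "(\<Sum>Q\<in>H. indicator {S. Q \<subseteq> S} S) = (\<Sum>Q\<in>H. if Q \<subseteq> S then 1 else (0::real))"
    by (intro sum.cong) (auto simp: indicator_def)
  also have "\<dots> = real (card {Q \<in> H. Q \<subseteq> S})"
    using assms by (simp add: sum.If_cases Int_def)
  finally show ?thesis by (simp add: copies_def)
qed

context
  fixes A :: "'a set" and q :: real and H :: "'a set set"
  assumes A: "finite A" and q: "0 \<le> q" "q \<le> 1" and H: "\<And>Q. Q \<in> H \<Longrightarrow> Q \<subseteq> A"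
begin

lemma finite_family: "finite H"
  using A H by (meson Pow_iff finite_Pow_iff finite_subset subsetI)

lemma integrable_random_subset: "integrable (random_subset A q) (f :: 'a set \<Rightarrow> real)"
  by (rule integrable_measure_pmf_finite[OF finite_set_random_subset[OF A]])

lemma expectation_copies:
  "measure_pmf.expectation (random_subset A q) (copies H) = (\<Sum>Q\<in>H. q ^ card Q)"
proof -
  have "measure_pmf.expectation (random_subset A q) (copies H)
      = measure_pmf.expectation (random_subset A q) (\<lambda>S. \<Sum>Q\<in>H. indicator {S. Q \<subseteq> S} S)"
    by (simp add: copies_eq_sum[OF finite_family, abs_def])
  also have "\<dots> = (\<Sum>Q\<in>H. measure_pmf.prob (random_subset A q) {S. Q \<subseteq> S})"
    by (subst Bochner_Integration.integral_sum) (auto intro: integrable_random_subset)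
  also have "\<dots> = (\<Sum>Q\<in>H. q ^ card Q)"
    by (intro sum.cong refl prob_contains_random_subset A q H)
  finally show ?thesis .
qed

text \<open>Disjoint members of the family occur independently, so their covariance vanishes; for
  intersecting ones the covariance is at most the probability that both occur.\<close>

lemma variance_copies_le:
  "measure_pmf.variance (random_subset A q) (copies H)
     \<le> (\<Sum>Q\<in>H. \<Sum>R\<in>{R\<in>H. Q \<inter> R \<noteq> {}}. q ^ card (Q \<union> R))"
proof -
  have fin: "finite Q" if "Q \<in> H" for Q
    using A H that finite_subset by blast
  have "measure_pmf.expectation (random_subset A q) (\<lambda>S. (copies H S)\<^sup>2)
      = measure_pmf.expectation (random_subset A q)
          (\<lambda>S. \<Sum>Q\<in>H. \<Sum>R\<in>H. indicator {S. Q \<union> R \<subseteq> S} S)"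
    by (simp add: copies_eq_sum[OF finite_family] power2_eq_square sum_product
        flip: indicator_inter_arith Collect_conj_eq)
  also have "\<dots> = (\<Sum>Q\<in>H. \<Sum>R\<in>H. measure_pmf.prob (random_subset A q) {S. Q \<union> R \<subseteq> S})"
    by (subst Bochner_Integration.integral_sum, rule integrable_random_subset,
        subst Bochner_Integration.integral_sum, rule integrable_random_subset) simp
  also have "\<dots> = (\<Sum>Q\<in>H. \<Sum>R\<in>H. q ^ card (Q \<union> R))"
    by (intro sum.cong refl prob_contains_random_subset A q) (use H in auto)
  finally have sq: "measure_pmf.expectation (random_subset A q) (\<lambda>S. (copies H S)\<^sup>2)
      = (\<Sum>Q\<in>H. \<Sum>R\<in>H. q ^ card (Q \<union> R))" .
  have "measure_pmf.variance (random_subset A q) (copies H)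
      = (\<Sum>Q\<in>H. \<Sum>R\<in>H. q ^ card (Q \<union> R)) - (\<Sum>Q\<in>H. q ^ card Q)\<^sup>2"
    by (subst measure_pmf.variance_eq) (simp_all add: integrable_random_subset sq expectation_copies)
  also have "\<dots> = (\<Sum>Q\<in>H. \<Sum>R\<in>H. q ^ card (Q \<union> R) - q ^ card Q * q ^ card R)"
    by (simp add: power2_eq_square sum_product sum_subtractf)
  also have "\<dots> \<le> (\<Sum>Q\<in>H. \<Sum>R\<in>H. if Q \<inter> R \<noteq> {} then q ^ card (Q \<union> R) else 0)"
    using q fin by (intro sum_mono) (auto simp: card_Un_disjoint power_add)
  also have "\<dots> = (\<Sum>Q\<in>H. \<Sum>R\<in>{R\<in>H. Q \<inter> R \<noteq> {}}. q ^ card (Q \<union> R))"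
    by (rule sum.cong[OF refl]) (simp only: sum.inter_filter[OF finite_family])
  finally show ?thesis .
qed

lemma prob_copies_deviate_le:
  assumes "0 < t" and "(\<Sum>Q\<in>H. \<Sum>R\<in>{R\<in>H. Q \<inter> R \<noteq> {}}. q ^ card (Q \<union> R)) \<le> v"
  shows "measure_pmf.prob (random_subset A q) {S. t \<le> \<bar>copies H S - (\<Sum>Q\<in>H. q ^ card Q)\<bar>} \<le> v / t\<^sup>2"
proof -
  have "measure_pmf.prob (random_subset A q) {S. t \<le> \<bar>copies H S - (\<Sum>Q\<in>H. q ^ card Q)\<bar>}
      \<le> measure_pmf.variance (random_subset A q) (copies H) / t\<^sup>2"
    using measure_pmf.Chebyshev_inequality[where f = "copies H" and a = t and M = "random_subset A q"] assms(1)
    by (simp add: integrable_random_subset expectation_copies)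
  also have "\<dots> \<le> v / t\<^sup>2"
    using variance_copies_le assms(2) by (intro divide_right_mono) auto
  finally show ?thesis .
qed

lemma prob_copies_large_le:
  assumes "0 < t"
  shows "measure_pmf.prob (random_subset A q) {S. t \<le> copies H S} \<le> (\<Sum>Q\<in>H. q ^ card Q) / t"
  using integral_Markov_inequality_measure[of "measure_pmf (random_subset A q)" "copies H" UNIV t] assms
  unfolding expectation_copies by (simp add: integrable_random_subset) (simp add: copies_def)

end

section \<open>Obstructions to the Sidon property\<close>

definition parallelograms :: "'a::ab_group_add set \<Rightarrow> 'a set set" where
  "parallelograms A = {Q. Q \<subseteq> A \<and> card Q = 4 \<and> (\<exists>a b c e. Q = {a, b, c, e} \<and> a + b = c + e)}"

definition progressions :: "'a::ab_group_add set \<Rightarrow> 'a set set" where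
  "progressions A = {Q. Q \<subseteq> A \<and> card Q = 3 \<and> (\<exists>a c e. Q = {a, c, e} \<and> a + a = c + e)}"

lemma finite_parallelograms: "finite A \<Longrightarrow> finite (parallelograms A)"
  by (rule finite_subset[of _ "Pow A"]) (auto simp: parallelograms_def)

lemma finite_progressions: "finite A \<Longrightarrow> finite (progressions A)"
  by (rule finite_subset[of _ "Pow A"]) (auto simp: progressions_def)

text \<open>If two of the four points in \<open>a + b = c + e\<close> on opposite sides coincide, then the solution is
  trivial by cancellation; if two on the same side do, it is a progression. Both sides can be doubled
  only in the trivial case, because there is no \<open>2\<close>-torsion.\<close>

lemma sidon_if_no_obstruction:
  fixes T :: "'a::ab_group_add set"
  assumes tf: "\<And>a c::'a. a + a = c + c \<Longrightarrow> a = c"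
    and no: "\<And>Q. Q \<in> parallelograms A \<union> progressions A \<Longrightarrow> \<not> Q \<subseteq> T" and "T \<subseteq> A"
  shows "sidon T"
  unfolding sidon_def
proof (intro ballI impI, rule ccontr)
  fix a b c e
  assume T: "a \<in> T" "b \<in> T" "c \<in> T" "e \<in> T" and eq: "a + b = c + e" and ne: "{a, b} \<noteq> {c, e}"
  have "a \<noteq> c" "b \<noteq> e" "a \<noteq> e" "b \<noteq> c"
    using eq ne by (auto simp: add.commute)
  consider "a = b" "c = e" | "a = b" "c \<noteq> e" | "a \<noteq> b" "c = e" | "a \<noteq> b" "c \<noteq> e" by blast
  then have "{a, b, c, e} \<in> parallelograms A \<union> progressions A"
  proof cases
    case 1
    then show ?thesis using tf[of a c] eq \<open>a \<noteq> c\<close> by simp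
  next
    case 2
    then have "card {a, c, e} = 3" using \<open>a \<noteq> c\<close> \<open>a \<noteq> e\<close> by simp
    then have "{a, c, e} \<in> progressions A"
      unfolding progressions_def using 2 eq T \<open>T \<subseteq> A\<close> by blast
    then show ?thesis using 2 by simp
  next
    case 3
    then have "card {c, a, b} = 3" using \<open>a \<noteq> c\<close> \<open>b \<noteq> c\<close> by auto
    then have "{c, a, b} \<in> progressions A"
      unfolding progressions_def using 3 eq[symmetric] T \<open>T \<subseteq> A\<close> by blast
    moreover have "{a, b, c, e} = {c, a, b}" using 3 by auto
    ultimately show ?thesis by simp
  next
    case 4
    then have "card {a, b, c, e} = 4"
      using \<open>a \<noteq> c\<close> \<open>b \<noteq> e\<close> \<open>a \<noteq> e\<close> \<open>b \<noteq> c\<close> by simp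
    then show ?thesis
      unfolding parallelograms_def using eq T \<open>T \<subseteq> A\<close> by blast
  qed
  then show False using no T by blast
qed

lemma max_sidon_le_card:
  assumes "finite S"
  shows "max_sidon S \<le> card S"
proof -
  have "sidon ({} :: 'a set)" by (simp add: sidon_def)
  then have "{card T | T. T \<subseteq> S \<and> sidon T} \<noteq> {}" by blast
  moreover have "finite {card T | T. T \<subseteq> S \<and> sidon T}"
    using assms by simp
  ultimately show ?thesis
    unfolding max_sidon_def using assms by (auto intro: card_mono)
qed

lemma card_le_max_sidon:
  assumes "finite S" "T \<subseteq> S" "sidon T"
  shows "card T \<le> max_sidon S"
  unfolding max_sidon_def using assms by (intro Max_ge) auto

text \<open>The deletion method: removing one point from every obstruction contained in \<open>S\<close> leaves a
  Sidon set.\<close>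

lemma max_sidon_ge_deletion:
  fixes A :: "'a::ab_group_add set"
  assumes tf: "\<And>a c::'a. a + a = c + c \<Longrightarrow> a = c" and A: "finite A" and "S \<subseteq> A"
  shows "real (card S) - copies (parallelograms A) S - copies (progressions A) S \<le> real (max_sidon S)"
proof -
  let ?P = "{Q \<in> parallelograms A. Q \<subseteq> S}" and ?R = "{Q \<in> progressions A. Q \<subseteq> S}"
  define D where "D = (\<lambda>Q. SOME x. x \<in> Q) ` (?P \<union> ?R)"
  have fin: "finite S" "finite ?P" "finite ?R"
    using A \<open>S \<subseteq> A\<close> finite_parallelograms[OF A] finite_progressions[OF A]
    by (auto intro: finite_subset)
  have "card D \<le> card ?P + card ?R"
    unfolding D_def by (rule le_trans[OF card_image_le card_Un_le]) (use fin in simp)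
  moreover have "card S - card D \<le> card (S - D)"
    by (rule diff_card_le_card_Diff) (use fin in \<open>simp add: D_def\<close>)
  moreover have "sidon (S - D)"
  proof (rule sidon_if_no_obstruction[OF tf])
    show "S - D \<subseteq> A" using \<open>S \<subseteq> A\<close> by blast
  next
    fix Q assume Q: "Q \<in> parallelograms A \<union> progressions A"
    show "\<not> Q \<subseteq> S - D"
    proof
      assume sub: "Q \<subseteq> S - D"
      have "Q \<noteq> {}" using Q by (auto simp: parallelograms_def progressions_def)
      then have "(SOME x. x \<in> Q) \<in> Q" by (simp add: some_in_eq)
      moreover have "(SOME x. x \<in> Q) \<in> D" unfolding D_def using Q sub by blast
      ultimately show False using sub by blast
    qed
  qed
  then have "card (S - D) \<le> max_sidon S"
    using fin by (intro card_le_max_sidon) auto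
  ultimately show ?thesis unfolding copies_def by linarith
qed

lemma card_progressions_le:
  assumes "finite A"
  shows "card (progressions A) \<le> card A ^ 2"
proof -
  have "progressions A \<subseteq> (\<lambda>(a, c). {a, c, a + a - c}) ` (A \<times> A)"
  proof
    fix Q assume "Q \<in> progressions A"
    then obtain a c e where Q: "Q \<subseteq> A" "Q = {a, c, e}" and eq: "a + a = c + e"
      unfolding progressions_def by blast
    have "a + a - c = e" by (simp add: eq)
    then have "Q = {a, c, a + a - c}" "a \<in> A" "c \<in> A" using Q by simp_all
    then show "Q \<in> (\<lambda>(a, c). {a, c, a + a - c}) ` (A \<times> A)"
      by (intro image_eqI[of _ _ "(a, c)"]) simp_all
  qed
  then have "card (progressions A) \<le> card (A \<times> A)"
    by (rule surj_card_le[rotated]) (use assms in simp)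
  then show ?thesis by (simp add: card_cartesian_product power2_eq_square)
qed

text \<open>The fourth point of an additive quadruple is determined by the other three, so quadruples are
  counted as triples.\<close>

definition sum_triples :: "'a::ab_group_add set \<Rightarrow> ('a \<times> 'a \<times> 'a) set" where
  "sum_triples A = {(a, b, c). a \<in> A \<and> b \<in> A \<and> c \<in> A \<and> a + b - c \<in> A}"

lemma sum_triples_subset: "sum_triples A \<subseteq> A \<times> A \<times> A"
  by (auto simp: sum_triples_def)

lemma card_sum_triples_le_cube: "finite A \<Longrightarrow> card (sum_triples A) \<le> card A ^ 3"
  using card_mono[OF _ sum_triples_subset, of A]
  by (simp add: card_cartesian_product power3_eq_cube mult.assoc)

text \<open>A parallelogram with diagonals \<open>{a, b}\<close> and \<open>{c, e}\<close> comes from eight triples: either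
  diagonal may provide the first two entries, in either order, and either end of the other diagonal
  the third.\<close>

lemma card_parallelograms_le:
  assumes "finite A"
  shows "8 * card (parallelograms A) \<le> card (sum_triples A)"
proof -
  define fib where "fib = (\<lambda>Q. {(a, b, c) \<in> sum_triples A. {a, b, c, a + b - c} = Q})"
  have fin: "finite (sum_triples A)"
    using assms finite_subset[OF sum_triples_subset] by blast
  have fib_subset: "fib Q \<subseteq> sum_triples A" for Q
    by (auto simp: fib_def)
  have fib: "8 \<le> card (fib Q)" if "Q \<in> parallelograms A" for Q
  proof -
    obtain a b c e where Q: "Q \<subseteq> A" "card Q = 4" "Q = {a, b, c, e}" "a + b = c + e"
      using \<open>Q \<in> parallelograms A\<close> unfolding parallelograms_def by blast
    have dist: "a \<noteq> b" "a \<noteq> c" "a \<noteq> e" "b \<noteq> c" "b \<noteq> e" "c \<noteq> e"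
      using Q(2) unfolding Q(3) by (auto simp: card_insert_if split: if_splits)
    have s: "a + b - c = e" "b + a - c = e" "a + b - e = c" "b + a - e = c"
      "c + e - a = b" "e + c - a = b" "c + e - b = a" "e + c - b = a"
      by (simp_all only: add.commute[of b a] add.commute[of e c] Q(4) add_diff_cancel_left'
          add_diff_cancel_right') (simp_all flip: Q(4))
    have sets: "{a, b, c, e} = Q" "{b, a, c, e} = Q" "{a, b, e, c} = Q" "{b, a, e, c} = Q"
      "{c, e, a, b} = Q" "{e, c, a, b} = Q" "{c, e, b, a} = Q" "{e, c, b, a} = Q"
      unfolding Q(3) by auto
    have mem: "(x, y, z) \<in> fib Q" if "x + y - z = w" "{x, y, z, w} = Q" for x y z w
      using Q(1) that unfolding fib_def sum_triples_def by auto
    let ?E = "{(a, b, c), (b, a, c), (a, b, e), (b, a, e), (c, e, a), (e, c, a), (c, e, b), (e, c, b)}"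
    have "?E \<subseteq> fib Q"
      using mem[OF s(1) sets(1)] mem[OF s(2) sets(2)] mem[OF s(3) sets(3)] mem[OF s(4) sets(4)]
        mem[OF s(5) sets(5)] mem[OF s(6) sets(6)] mem[OF s(7) sets(7)] mem[OF s(8) sets(8)]
      by simp
    moreover have "card ?E = 8" using dist by simp
    moreover have "finite (fib Q)" by (rule finite_subset[OF fib_subset fin])
    ultimately show ?thesis by (metis card_mono)
  qed
  have "8 * card (parallelograms A) \<le> (\<Sum>Q\<in>parallelograms A. card (fib Q))"
    using sum_mono[of "parallelograms A" "\<lambda>_. 8" "\<lambda>Q. card (fib Q)"] fib by simp
  also have "\<dots> = card (\<Union>Q\<in>parallelograms A. fib Q)"
    using finite_subset[OF fib_subset fin] finite_parallelograms[OF assms]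
    by (intro card_UN_disjoint[symmetric]) (auto simp: fib_def)
  also have "\<dots> \<le> card (sum_triples A)"
    using fib_subset by (intro card_mono fin) blast
  finally show ?thesis .
qed

text \<open>Any three points of a parallelogram determine the fourth up to boundedly many choices. The
  omitted point can be taken outside \<open>Q\<close>, so only \<open>j\<close> of the remaining three are free. The constant
  is crude: \<open>16\<close> subsets of \<open>Q\<close> times \<open>27\<close> triples from three points.\<close>

lemma card_parallelograms_overlapping_le:
  fixes A :: "'a::ab_group_add set"
  assumes A: "finite A" and Q: "card Q = 4"
  shows "card {R \<in> parallelograms A. card (R - Q) = Suc j} \<le> 432 * card A ^ j"
proof -
  define I where "I = {(U, V). U \<in> Pow Q \<and> V \<subseteq> A \<and> card V = j \<and> card (U \<union> V) = 3}"
  define ext where "ext = (\<lambda>K::'a set. (\<lambda>(x, y, z). insert (x + y - z) K) ` (K \<times> K \<times> K))"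
  have "finite Q" using Q by (metis card.infinite zero_neq_numeral)
  have subI: "I \<subseteq> Pow Q \<times> {V. V \<subseteq> A \<and> card V = j}" by (auto simp: I_def)
  have fin: "finite (Pow Q \<times> {V. V \<subseteq> A \<and> card V = j})"
    using A \<open>finite Q\<close> by auto
  have "card {V. V \<subseteq> A \<and> card V = j} \<le> card A ^ j"
    using n_subsets[OF A, of j] binomial_le_pow[of j "card A"]
    by (cases "j \<le> card A") (auto simp: binomial_eq_0)
  then have cardI: "card I \<le> 16 * card A ^ j"
    using card_mono[OF fin subI] Q \<open>finite Q\<close> by (simp add: card_cartesian_product card_Pow)
  have ext: "card (ext K) \<le> 27" if "card K = 3" for K
  proof -
    have "finite K" using that by (metis card.infinite zero_neq_numeral)
    then have "card (ext K) \<le> card (K \<times> K \<times> K)" unfolding ext_def by (intro card_image_le) auto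
    then show ?thesis using that by (simp add: card_cartesian_product)
  qed
  have "{R \<in> parallelograms A. card (R - Q) = Suc j} \<subseteq> (\<Union>(U, V)\<in>I. ext (U \<union> V))"
  proof
    fix R assume "R \<in> {R \<in> parallelograms A. card (R - Q) = Suc j}"
    then obtain a b c e where R: "R \<subseteq> A" "card R = 4" "R = {a, b, c, e}" "a + b = c + e"
      and j: "card (R - Q) = Suc j"
      unfolding parallelograms_def by blast
    then obtain w where w: "w \<in> R" "w \<notin> Q"
      by (metis Diff_iff card.empty equals0I nat.distinct(1))
    have dist: "a \<noteq> b" "a \<noteq> c" "a \<noteq> e" "b \<noteq> c" "b \<noteq> e" "c \<noteq> e"
      using R(2) unfolding R(3) by (auto simp: card_insert_if split: if_splits)
    have s: "a = c + e - b" "b = c + e - a" by (simp_all flip: R(4))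
    have s': "c = a + b - e" "e = a + b - c" by (simp_all add: R(4))
    have "\<exists>x\<in>R - {w}. \<exists>y\<in>R - {w}. \<exists>z\<in>R - {w}. w = x + y - z"
    proof -
      consider "w = a" | "w = b" | "w = c" | "w = e" using w R(3) by blast
      then show ?thesis
      proof cases
        case 1 then show ?thesis using dist s(1) unfolding R(3)
          by (intro bexI[of _ c] bexI[of _ e] bexI[of _ b]) auto
      next
        case 2 then show ?thesis using dist s(2) unfolding R(3)
          by (intro bexI[of _ c] bexI[of _ e] bexI[of _ a]) auto
      next
        case 3 then show ?thesis using dist s'(1) unfolding R(3)
          by (intro bexI[of _ a] bexI[of _ b] bexI[of _ e]) auto
      next
        case 4 then show ?thesis using dist s'(2) unfolding R(3)
          by (intro bexI[of _ a] bexI[of _ b] bexI[of _ c]) auto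
      qed
    qed
    then obtain x y z where xyz: "x \<in> R - {w}" "y \<in> R - {w}" "z \<in> R - {w}" "w = x + y - z"
      by blast
    have "insert (x + y - z) (R - {w}) = R" using xyz(4) w(1) by blast
    then have "R \<in> ext (R - {w})"
      unfolding ext_def using xyz(1-3) by (intro image_eqI[of _ _ "(x, y, z)"]) auto
    moreover have K: "(R \<inter> Q) \<union> (R - Q - {w}) = R - {w}" using w by auto
    moreover have "(R \<inter> Q, R - Q - {w}) \<in> I"
      unfolding I_def using R(1,2) j w K by (simp add: card_Diff_singleton_if) auto
    ultimately show "R \<in> (\<Union>(U, V)\<in>I. ext (U \<union> V))"
      by (intro UN_I[of "(R \<inter> Q, R - Q - {w})"]) auto
  qed
  moreover have finI: "finite I" using finite_subset[OF subI fin] .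
  moreover have "finite (case x of (U, V) \<Rightarrow> ext (U \<union> V))" if "x \<in> I" for x
    using that unfolding I_def ext_def
    by (auto intro!: finite_imageI finite_cartesian_product)
       (metis card.infinite finite_Un zero_neq_numeral)+
  ultimately have "card {R \<in> parallelograms A. card (R - Q) = Suc j}
      \<le> card (\<Union>(U, V)\<in>I. ext (U \<union> V))"
    by (intro card_mono) auto
  also have "\<dots> \<le> (\<Sum>(U, V)\<in>I. card (ext (U \<union> V)))"
    using card_UN_le[OF finI, of "\<lambda>(U, V). ext (U \<union> V)"] by (simp add: case_prod_unfold)
  also have "\<dots> \<le> (\<Sum>_\<in>I. 27)"
    by (intro sum_mono) (auto simp: I_def intro!: ext)
  also have "\<dots> \<le> 432 * card A ^ j" using cardI by simp
  finally show ?thesis .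
qed

text \<open>The right-hand side groups the parallelograms meeting \<open>Q\<close> by their number \<open>k < 4\<close> of points
  outside \<open>Q\<close>. For \<open>k = 0\<close> there is only \<open>Q\<close> itself; each \<open>k > 0\<close> contributes at most
  \<open>432 * N ^ (k - 1) * q ^ k\<close>.\<close>

lemma overlap_sum_parallelograms_le:
  fixes A :: "'a::ab_group_add set"
  assumes A: "finite A" and q: "0 \<le> q"
  defines "N \<equiv> real (card A)"
  shows "(\<Sum>Q\<in>parallelograms A. \<Sum>R\<in>{R\<in>parallelograms A. Q \<inter> R \<noteq> {}}. q ^ card (Q \<union> R))
    \<le> real (card (parallelograms A)) * q ^ 4 * (1 + 432 * (q + N * q\<^sup>2 + N\<^sup>2 * q ^ 3))"
proof -
  let ?P = "parallelograms A"
  have finP: "finite ?P" by (rule finite_parallelograms[OF A])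
  have inner: "(\<Sum>R\<in>{R\<in>?P. Q \<inter> R \<noteq> {}}. q ^ card (Q \<union> R))
      \<le> q ^ 4 * (1 + 432 * (q + N * q\<^sup>2 + N\<^sup>2 * q ^ 3))" if Q: "Q \<in> ?P" for Q
  proof -
    have cQ: "card Q = 4" and fQ: "finite Q"
      using Q A by (auto simp: parallelograms_def intro: finite_subset)
    have cR: "card R = 4" "finite R" if "R \<in> ?P" for R
      using that A by (auto simp: parallelograms_def intro: finite_subset)
    let ?M = "{R\<in>?P. Q \<inter> R \<noteq> {}}"
    have un: "card (Q \<union> R) = 4 + card (R - Q)" if "R \<in> ?P" for R
      using card_Un_disjoint[of Q "R - Q"] cQ fQ cR[OF that] by simp
    have lt: "card (R - Q) < 4" if "R \<in> ?M" for R
    proof -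
      have "R - Q \<subset> R" "R \<in> ?P" using that by blast+
      then have "card (R - Q) < card R" using cR(2) by (intro psubset_card_mono)
      then show ?thesis using cR(1)[OF \<open>R \<in> ?P\<close>] by simp
    qed
    have zero: "{R\<in>?M. card (R - Q) = 0} \<subseteq> {Q}"
    proof
      fix R assume "R \<in> {R\<in>?M. card (R - Q) = 0}"
      then have "R \<subseteq> Q" "card R = 4" using cR[of R] by auto
      then show "R \<in> {Q}" using card_subset_eq[OF fQ, of R] cQ by simp
    qed
    have "(\<Sum>R\<in>?M. q ^ card (Q \<union> R)) = (\<Sum>R\<in>?M. q ^ 4 * q ^ card (R - Q))"
      by (intro sum.cong) (auto simp: un power_add)
    also have "\<dots> = q ^ 4 * (\<Sum>k<4. \<Sum>R\<in>{R\<in>?M. card (R - Q) = k}. q ^ card (R - Q))"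
    proof (subst sum.group)
      show "finite ?M" using finP by simp
      show "(\<lambda>R. card (R - Q)) ` ?M \<subseteq> {..<4}" using lt by blast
    qed (simp_all add: sum_distrib_left)
    also have "\<dots> = q ^ 4 * (\<Sum>k<4. \<Sum>R\<in>{R\<in>?M. card (R - Q) = k}. q ^ k)"
      by (intro arg_cong2[where f = "(*)"] sum.cong refl) blast
    also have "\<dots> = q ^ 4 * (\<Sum>k<4. real (card {R\<in>?M. card (R - Q) = k}) * q ^ k)"
      by (simp only: sum_constant)
    also have "\<dots> \<le> q ^ 4 * (\<Sum>k<4. (if k = 0 then 1 else 432 * N ^ (k - 1)) * q ^ k)"
    proof (intro mult_left_mono sum_mono mult_right_mono)
      fix k :: nat
      show "real (card {R\<in>?M. card (R - Q) = k}) \<le> (if k = 0 then 1 else 432 * N ^ (k - 1))"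
      proof (cases k)
        case 0
        have "card {R\<in>?M. card (R - Q) = 0} \<le> card {Q}"
          by (rule card_mono[OF _ zero]) simp
        then show ?thesis using 0 by simp
      next
        case (Suc j)
        have "card {R\<in>?M. card (R - Q) = k} \<le> card {R\<in>?P. card (R - Q) = Suc j}"
          using finP Suc by (intro card_mono) auto
        also have "\<dots> \<le> 432 * card A ^ j"
          by (rule card_parallelograms_overlapping_le[OF A cQ])
        finally have "real (card {R\<in>?M. card (R - Q) = k}) \<le> real (432 * card A ^ j)"
          by (simp only: of_nat_le_iff)
        then show ?thesis using Suc by (simp add: N_def)
      qed
    qed (use q in auto)
    also have "\<dots> = q ^ 4 * (1 + 432 * (q + N * q\<^sup>2 + N\<^sup>2 * q ^ 3))"
      by (simp add: eval_nat_numeral algebra_simps)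
    finally show ?thesis .
  qed
  have "(\<Sum>Q\<in>?P. \<Sum>R\<in>{R\<in>?P. Q \<inter> R \<noteq> {}}. q ^ card (Q \<union> R))
      \<le> (\<Sum>Q\<in>?P. q ^ 4 * (1 + 432 * (q + N * q\<^sup>2 + N\<^sup>2 * q ^ 3)))"
    by (intro sum_mono inner)
  then show ?thesis by (simp add: mult.assoc)
qed

section \<open>Additive triples in the grid\<close>

text \<open>For given \<open>a\<close> and \<open>c\<close> the admissible \<open>b\<close> form an interval of length \<open>n - |a - c|\<close>. The sum of
  these lengths is evaluated by induction: passing from \<open>n\<close> to \<open>n + 1\<close> adds \<open>1\<close> to each of the
  \<open>n\<^sup>2\<close> old terms, and two borders and a corner of new terms.\<close>

lemma card_sum_triples_interval:
  "3 * card (sum_triples {0..<int n}) = 2 * n ^ 3 + n"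
proof -
  have fibre: "card {b \<in> {0..<int n}. a + b - c \<in> {0..<int n}} = nat (int n - \<bar>a - c\<bar>)"
    if "a \<in> {0..<int n}" "c \<in> {0..<int n}" for a c
  proof -
    have "{b \<in> {0..<int n}. a + b - c \<in> {0..<int n}} = {max 0 (c - a)..<min (int n) (int n + c - a)}"
      by auto
    moreover have "min (int n) (int n + c - a) - max 0 (c - a) = int n - \<bar>a - c\<bar>"
      by linarith
    ultimately show ?thesis by (simp only: card_atLeastLessThan_int)
  qed
  have fin: "finite {b \<in> {0..<int n}. P b}" for P
    by (rule finite_subset[of _ "{0..<int n}"]) auto
  have "card (sum_triples {0..<int n})
      = card (SIGMA a:{0..<int n}. SIGMA c:{0..<int n}. {b \<in> {0..<int n}. a + b - c \<in> {0..<int n}})"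
    by (intro bij_betw_same_card[of "\<lambda>(a, b, c). (a, c, b)"]
        bij_betw_byWitness[where f' = "\<lambda>(a, c, b). (a, b, c)"])
       (auto simp: sum_triples_def)
  also have "\<dots> = (\<Sum>a\<in>{0..<int n}. \<Sum>c\<in>{0..<int n}.
      card {b \<in> {0..<int n}. a + b - c \<in> {0..<int n}})"
    by (simp only: card_SigmaI finite_SigmaI fin finite_atLeastLessThan_int ball_triv simp_thms)
  also have "\<dots> = (\<Sum>a\<in>{0..<int n}. \<Sum>c\<in>{0..<int n}. nat (int n - \<bar>a - c\<bar>))"
    by (intro sum.cong refl fibre)
  finally have "int (card (sum_triples {0..<int n}))
      = (\<Sum>a\<in>{0..<int n}. \<Sum>c\<in>{0..<int n}. int (nat (int n - \<bar>a - c\<bar>)))"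
    by (simp only: of_nat_sum)
  also have "\<dots> = (\<Sum>a\<in>{0..<int n}. \<Sum>c\<in>{0..<int n}. int n - \<bar>a - c\<bar>)"
    by (intro sum.cong refl) auto
  also have "\<dots> = (\<Sum>a<n. \<Sum>c<n. int n - \<bar>int a - int c\<bar>)"
  proof -
    have bij: "bij_betw int {..<n} {0..<int n}"
      by (rule bij_betw_byWitness[where f' = nat]) auto
    show ?thesis by (simp add: sum.reindex_bij_betw[OF bij, symmetric])
  qed
  finally have card: "int (card (sum_triples {0..<int n}))
      = (\<Sum>a<n. \<Sum>c<n. int n - \<bar>int a - int c\<bar>)" .
  have "3 * (\<Sum>a<n. \<Sum>c<n. int n - \<bar>int a - int c\<bar>) = 2 * int n ^ 3 + int n"
  proof (induction n)
    case (Suc n)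
    have border: "(\<Sum>a<n. int (Suc n) - \<bar>int a - int n\<bar>) = (\<Sum>a<n. int a + 1)"
      by (intro sum.cong) auto
    have border': "(\<Sum>a<n. int (Suc n) - \<bar>int n - int a\<bar>) = (\<Sum>a<n. int a + 1)"
      by (intro sum.cong) auto
    have gauss: "2 * (\<Sum>a<n. int a + 1) = int n * (int n + 1)"
      by (induction n) (auto simp: algebra_simps)
    have "(\<Sum>a<n. \<Sum>c<n. int (Suc n) - \<bar>int a - int c\<bar>)
        = (\<Sum>a<n. \<Sum>c<n. (int n - \<bar>int a - int c\<bar>) + 1)"
      by (intro sum.cong) auto
    also have "\<dots> = (\<Sum>a<n. \<Sum>c<n. int n - \<bar>int a - int c\<bar>) + int n * int n"
      by (simp only: sum.distrib) simp
    finally have inner: "(\<Sum>a<n. \<Sum>c<n. int (Suc n) - \<bar>int a - int c\<bar>)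
        = (\<Sum>a<n. \<Sum>c<n. int n - \<bar>int a - int c\<bar>) + int n * int n" .
    have "(\<Sum>a<Suc n. \<Sum>c<Suc n. int (Suc n) - \<bar>int a - int c\<bar>)
        = (\<Sum>a<n. \<Sum>c<n. int (Suc n) - \<bar>int a - int c\<bar>)
          + (\<Sum>a<n. int (Suc n) - \<bar>int a - int n\<bar>)
          + (\<Sum>a<n. int (Suc n) - \<bar>int n - int a\<bar>) + (int n + 1)"
      by (simp only: sum.lessThan_Suc sum.distrib)
    also have "\<dots> = (\<Sum>a<n. \<Sum>c<n. int n - \<bar>int a - int c\<bar>) + int n * int n
          + int n * (int n + 1) + (int n + 1)"
      unfolding inner border border' using gauss by linarith
    finally have step: "(\<Sum>a<Suc n. \<Sum>c<Suc n. int (Suc n) - \<bar>int a - int c\<bar>)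
        = (\<Sum>a<n. \<Sum>c<n. int n - \<bar>int a - int c\<bar>) + int n * int n
          + int n * (int n + 1) + (int n + 1)" .
    have "3 * (\<Sum>a<Suc n. \<Sum>c<Suc n. int (Suc n) - \<bar>int a - int c\<bar>)
       = (2 * int n ^ 3 + int n) + 3 * (int n * int n + int n * (int n + 1) + (int n + 1))"
      by (simp only: step distrib_left Suc.IH add.assoc)
    also have "\<dots> = 2 * int (Suc n) ^ 3 + int (Suc n)"
      by (simp add: power3_eq_cube algebra_simps)
    finally show ?case .
  qed simp
  then have "int (3 * card (sum_triples {0..<int n})) = int (2 * n ^ 3 + n)"
    using card by simp
  then show ?thesis by (simp only: of_nat_eq_iff)
qed

lemma card_sum_triples_grid_le:
  "card (sum_triples (grid n :: (int ^ 'd) set)) \<le> card (sum_triples {0..<int n}) ^ CARD('d)"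
proof -
  let ?f = "\<lambda>(a, b, c) i. ((a :: int ^ 'd) $ i, b $ i, c $ i)"
  let ?P = "UNIV \<rightarrow>\<^sub>E sum_triples {0..<int n} :: ('d \<Rightarrow> int \<times> int \<times> int) set"
  have "finite (sum_triples {0..<int n})"
    by (rule finite_subset[OF sum_triples_subset]) simp
  then have fin: "finite ?P" by (intro finite_PiE) auto
  have inj: "inj_on ?f (sum_triples (grid n))"
  proof (rule inj_onI)
    fix t t' :: "(int ^ 'd) \<times> (int ^ 'd) \<times> (int ^ 'd)"
    assume eq: "?f t = ?f t'"
    obtain a b c a' b' c' where t: "t = (a, b, c)" "t' = (a', b', c')"
      by (metis prod_cases3)
    have "(a $ i, b $ i, c $ i) = (a' $ i, b' $ i, c' $ i)" for i
      using fun_cong[OF eq, of i] by (simp add: t)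
    then show "t = t'" by (simp add: t vec_eq_iff)
  qed
  have "?f ` sum_triples (grid n) \<subseteq> ?P"
  proof (intro image_subsetI PiE_I)
    fix t :: "(int ^ 'd) \<times> (int ^ 'd) \<times> (int ^ 'd)" and i
    assume "t \<in> sum_triples (grid n)"
    then show "?f t i \<in> sum_triples {0..<int n}"
      by (cases t) (simp add: sum_triples_def grid_def)
  qed simp
  then have "card (sum_triples (grid n :: (int ^ 'd) set)) \<le> card ?P"
    by (rule card_inj_on_le[OF inj _ fin])
  then show ?thesis by (simp add: card_PiE)
qed

text \<open>The density of additive triples in the \<open>d\<close>-dimensional grid is at most the \<open>d\<close>-th power of the
  one-dimensional density \<open>2/3 + 1/(3n\<^sup>2)\<close>, so dimension one is the worst case. The factor \<open>1/8\<close>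
  between parallelograms and triples turns \<open>2/3\<close> into \<open>1/12\<close>.\<close>

lemma card_parallelograms_grid_le:
  assumes "0 < n"
  shows "real (card (parallelograms (grid n :: (int ^ 'd) set)))
    \<le> (real n ^ CARD('d)) ^ 3 * (1 / 12 + 1 / (24 * (real n)\<^sup>2))"
proof -
  let ?T = "real (card (sum_triples {0..<int n}))"
  define \<rho> where "\<rho> = 2 / 3 + 1 / (3 * (real n)\<^sup>2)"
  have "real (3 * card (sum_triples {0..<int n})) = real (2 * n ^ 3 + n)"
    by (simp only: card_sum_triples_interval)
  then have T: "?T = real n ^ 3 * \<rho>"
    using assms by (simp add: \<rho>_def field_simps power3_eq_cube power2_eq_square)
  have "1 \<le> (real n)\<^sup>2" using assms by simp
  then have \<rho>: "0 \<le> \<rho>" "\<rho> \<le> 1" by (auto simp: \<rho>_def divide_simps)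
  have "8 * real (card (parallelograms (grid n :: (int ^ 'd) set)))
      \<le> real (card (sum_triples (grid n :: (int ^ 'd) set)))"
    using card_parallelograms_le[OF finite_grid[where 'a = 'd and n = n]] by linarith
  also have "\<dots> \<le> ?T ^ CARD('d)"
    using card_sum_triples_grid_le[where 'd = 'd, of n] by (metis of_nat_le_iff of_nat_power)
  also have "\<dots> = (real n ^ CARD('d)) ^ 3 * \<rho> ^ CARD('d)"
    unfolding T power_mult_distrib by (simp add: power_mult[symmetric] mult.commute)
  also have "\<dots> \<le> (real n ^ CARD('d)) ^ 3 * \<rho>"
    using \<rho> power_decreasing[of 1 "CARD('d)" \<rho>] by (intro mult_left_mono) auto
  finally show ?thesis by (simp add: \<rho>_def field_simps)
qed

section \<open>The random grid\<close>

text \<open>The three sources of error are the size of the random set and the numbers of parallelograms and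
  of progressions in it; each deviates by \<open>\<epsilon> N q\<close> with probability \<open>O(1 / N q)\<close>. The size is treated as
  the number of singletons contained in the random set, so that the same second moment bound serves for
  it and for the parallelograms.\<close>

lemma prob_max_sidon_deviates_le:
  fixes A :: "'a::ab_group_add set"
  assumes tf: "\<And>a c::'a. a + a = c + c \<Longrightarrow> a = c"
    and A: "finite A" and q: "0 \<le> q" "q \<le> 1" and \<epsilon>: "0 < \<epsilon>"
  defines "N \<equiv> real (card A)"
  assumes large: "1 \<le> N * q" and small: "N\<^sup>2 * q ^ 3 \<le> 8"
  shows "measure_pmf.prob (random_subset A q)
      {S. \<not> ((1 - 3 * \<epsilon>) * (N * q) - real (card (parallelograms A)) * q ^ 4 \<le> real (max_sidon S) \<and>
             real (max_sidon S) \<le> (1 + \<epsilon>) * (N * q))}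
    \<le> (7346 / \<epsilon>\<^sup>2 + 8 / \<epsilon>) / (N * q)"
proof -
  let ?M = "random_subset A q"
  define m where "m = N * q"
  define points where "points = (\<lambda>x. {x}) ` A"
  have m: "1 \<le> m" using large by (simp add: m_def)
  have eq3: "N\<^sup>2 * q ^ 3 = m * (N * q\<^sup>2)" "N ^ 3 * q ^ 4 = m * (N\<^sup>2 * q ^ 3)"
    by (auto simp: m_def eval_nat_numeral)
  \<comment> \<open>The middle term of the variance bound is controlled by the outer ones:
    \<open>N q\<^sup>2 = N\<^sup>2 q\<^sup>3 / (N q)\<close> and \<open>N q \<ge> 1\<close>.\<close>
  have "0 \<le> N * q\<^sup>2" by (simp add: N_def)
  then have "N * q\<^sup>2 \<le> m * (N * q\<^sup>2)" using m mult_right_mono[of 1 m "N * q\<^sup>2"] by simp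
  then have mid: "N * q\<^sup>2 \<le> 8" using small eq3 by linarith
  have sum_points: "(\<Sum>Q\<in>points. q ^ card Q) = m"
    by (simp add: points_def sum.reindex m_def N_def)
  have points_sub: "Q \<subseteq> A" if "Q \<in> points" for Q
    using that by (auto simp: points_def)
  have "(\<Sum>Q\<in>points. \<Sum>R\<in>{R\<in>points. Q \<inter> R \<noteq> {}}. q ^ card (Q \<union> R)) = (\<Sum>Q\<in>points. q)"
  proof (rule sum.cong)
    fix Q assume "Q \<in> points"
    then have "{R\<in>points. Q \<inter> R \<noteq> {}} = {Q}" "card Q = 1" by (auto simp: points_def)
    then show "(\<Sum>R\<in>{R\<in>points. Q \<inter> R \<noteq> {}}. q ^ card (Q \<union> R)) = q" by simp
  qed simp
  also have "\<dots> = m" by (simp add: points_def card_image m_def N_def)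
  finally have 1: "measure_pmf.prob ?M {S. \<epsilon> * m \<le> \<bar>copies points S - m\<bar>} \<le> m / (\<epsilon> * m)\<^sup>2"
    using prob_copies_deviate_le[OF A q, of points "\<epsilon> * m" m] \<epsilon> m
    by (simp add: sum_points points_sub)
  have P4: "card Q = 4" "Q \<subseteq> A" if "Q \<in> parallelograms A" for Q
    using that by (auto simp: parallelograms_def)
  have P3: "card Q = 3" "Q \<subseteq> A" if "Q \<in> progressions A" for Q
    using that by (auto simp: progressions_def)
  have cP: "8 * real (card (parallelograms A)) \<le> N ^ 3"
  proof -
    have "8 * card (parallelograms A) \<le> card A ^ 3"
      using card_parallelograms_le[OF A] card_sum_triples_le_cube[OF A] by linarith
    then have "real (8 * card (parallelograms A)) \<le> real (card A ^ 3)" by (simp only: of_nat_le_iff)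
    then show ?thesis by (simp add: N_def)
  qed
  have "(\<Sum>Q\<in>parallelograms A. \<Sum>R\<in>{R\<in>parallelograms A. Q \<inter> R \<noteq> {}}. q ^ card (Q \<union> R))
      \<le> real (card (parallelograms A)) * q ^ 4 * (1 + 432 * (q + N * q\<^sup>2 + N\<^sup>2 * q ^ 3))"
    unfolding N_def by (rule overlap_sum_parallelograms_le[OF A q(1)])
  also have "\<dots> \<le> (N ^ 3 / 8 * q ^ 4) * (1 + 432 * (1 + 8 + 8))"
    using cP q mid small by (intro mult_mono mult_right_mono) (auto simp: N_def)
  also have "\<dots> \<le> 7345 * m"
  proof -
    have "N ^ 3 * q ^ 4 \<le> m * 8" unfolding eq3(2) using small m by (intro mult_left_mono) auto
    then show ?thesis by simp
  qed
  finally have 2: "measure_pmf.prob ?M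
      {S. \<epsilon> * m \<le> \<bar>copies (parallelograms A) S - real (card (parallelograms A)) * q ^ 4\<bar>}
      \<le> 7345 * m / (\<epsilon> * m)\<^sup>2"
    using prob_copies_deviate_le[OF A q, of "parallelograms A" "\<epsilon> * m" "7345 * m"] \<epsilon> m P4
    by simp
  have "real (card (progressions A)) \<le> N\<^sup>2"
    using card_progressions_le[OF A] by (simp add: N_def flip: of_nat_power)
  then have "real (card (progressions A)) * q ^ 3 \<le> 8"
    using small q mult_right_mono[of "real (card (progressions A))" "N\<^sup>2" "q ^ 3"] by force
  then have "real (card (progressions A)) * q ^ 3 / (\<epsilon> * m) \<le> 8 / (\<epsilon> * m)"
    using \<epsilon> m by (intro divide_right_mono) auto
  then have 3: "measure_pmf.prob ?M {S. \<epsilon> * m \<le> copies (progressions A) S} \<le> 8 / (\<epsilon> * m)"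
    using prob_copies_large_le[OF A q, of "progressions A" "\<epsilon> * m"] \<epsilon> m P3 by simp
  let ?E1 = "{S. \<epsilon> * m \<le> \<bar>copies points S - m\<bar>}"
  let ?E2 = "{S. \<epsilon> * m \<le> \<bar>copies (parallelograms A) S - real (card (parallelograms A)) * q ^ 4\<bar>}"
  let ?E3 = "{S. \<epsilon> * m \<le> copies (progressions A) S}"
  let ?B = "{S. \<not> ((1 - 3 * \<epsilon>) * (N * q) - real (card (parallelograms A)) * q ^ 4 \<le> real (max_sidon S) \<and>
             real (max_sidon S) \<le> (1 + \<epsilon>) * (N * q))}"
  have bad: "S \<in> ?E1 \<union> ?E2 \<union> ?E3" if S: "S \<in> ?B" "S \<in> set_pmf ?M" for S
  proof (rule ccontr)
    assume no: "S \<notin> ?E1 \<union> ?E2 \<union> ?E3"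
    have SA: "S \<subseteq> A" using set_random_subset[OF A S(2)] .
    have "{Q \<in> points. Q \<subseteq> S} = (\<lambda>x. {x}) ` S" using SA by (auto simp: points_def)
    then have "copies points S = real (card S)" by (simp add: copies_def card_image)
    moreover have "max_sidon S \<le> card S" using SA A finite_subset max_sidon_le_card by blast
    moreover note max_sidon_ge_deletion[OF tf A SA]
    ultimately show False using no S(1) by (auto simp: m_def[symmetric] algebra_simps)
  qed
  have "measure_pmf.prob ?M ?B = measure_pmf.prob ?M (?B \<inter> set_pmf ?M)"
    by (simp add: measure_Int_set_pmf)
  also have "\<dots> \<le> measure_pmf.prob ?M (?E1 \<union> ?E2 \<union> ?E3)"
    by (rule measure_pmf.finite_measure_mono) (use bad in blast, simp)
  also have "\<dots> \<le> measure_pmf.prob ?M (?E1 \<union> ?E2) + measure_pmf.prob ?M ?E3"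
    by (rule measure_Un_le) auto
  also have "\<dots> \<le> measure_pmf.prob ?M ?E1 + measure_pmf.prob ?M ?E2 + measure_pmf.prob ?M ?E3"
    by (intro add_right_mono measure_Un_le) auto
  also have "\<dots> \<le> m / (\<epsilon> * m)\<^sup>2 + 7345 * m / (\<epsilon> * m)\<^sup>2 + 8 / (\<epsilon> * m)"
    by (intro add_mono 1 2 3)
  also have "\<dots> = (7346 / \<epsilon>\<^sup>2 + 8 / \<epsilon>) / m"
    using \<epsilon> m by (simp add: field_simps power2_eq_square)
  finally show ?thesis by (simp add: m_def)
qed

text \<open>Here \<open>\<kappa>\<close> bounds the proportion of points lost to parallelograms. The gap between \<open>\<kappa>\<close> and
  \<open>\<theta>\<close> leaves room for four errors: three for the random fluctuations and one for the error term
  \<open>1 / (3 n\<^sup>2)\<close> in the number of parallelograms.\<close>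

lemma aas_max_sidon:
  fixes p :: "nat \<Rightarrow> real" and \<kappa> \<theta> \<eta> :: real
  defines "N \<equiv> \<lambda>n. real n ^ CARD('d::finite)"
  assumes p: "\<And>n. n > 0 \<Longrightarrow> 0 \<le> p n \<and> p n \<le> 1"
    and large: "filterlim (\<lambda>n. N n * p n) at_top sequentially"
    and small: "eventually (\<lambda>n. (N n)\<^sup>2 * p n ^ 3 \<le> 8) sequentially"
    and \<kappa>: "eventually (\<lambda>n. (N n)\<^sup>2 * p n ^ 3 / 12 \<le> \<kappa>) sequentially"
    and \<theta>: "\<kappa> < \<theta>" and \<eta>: "0 < \<eta>"
  shows "aas (\<lambda>n. random_subset (grid n :: (int ^ 'd) set) (p n))
          (\<lambda>n S. (1 - \<theta>) * (N n * p n) \<le> real (max_sidon S) \<and>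
                  real (max_sidon S) \<le> (1 + \<eta>) * (N n * p n))"
proof -
  let ?M = "\<lambda>n. random_subset (grid n :: (int ^ 'd) set) (p n)"
  let ?good = "\<lambda>n (S :: (int ^ 'd) set). (1 - \<theta>) * (N n * p n) \<le> real (max_sidon S) \<and>
                  real (max_sidon S) \<le> (1 + \<eta>) * (N n * p n)"
  define \<epsilon> where "\<epsilon> = min \<eta> ((\<theta> - \<kappa>) / 4)"
  define C where "C = 7346 / \<epsilon>\<^sup>2 + 8 / \<epsilon>"
  have \<epsilon>: "0 < \<epsilon>" using \<eta> \<theta> by (simp add: \<epsilon>_def)
  have tf: "a = c" if "a + a = c + c" for a c :: "int ^ 'd"
    using that by (simp add: vec_eq_iff)
  have lim: "(\<lambda>n. 1 - C / (N n * p n)) \<longlonglongrightarrow> 1 - 0"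
    by (intro tendsto_diff tendsto_const tendsto_divide_0[OF tendsto_const]
        filterlim_at_top_imp_at_infinity large)
  have "(\<lambda>n. 1 / (3 * (real n)\<^sup>2)) \<longlonglongrightarrow> 0"
    by (intro tendsto_divide_0[OF tendsto_const] filterlim_at_top_imp_at_infinity
        filterlim_tendsto_pos_mult_at_top[OF tendsto_const] filterlim_pow_at_top
        filterlim_real_sequentially) auto
  then have corr: "eventually (\<lambda>n. 1 / (3 * (real n)\<^sup>2) < \<epsilon>) sequentially"
    using \<epsilon> by (rule order_tendstoD)
  have "eventually (\<lambda>n. 1 \<le> N n * p n) sequentially"
    using large by (simp add: filterlim_at_top)
  then have low: "eventually (\<lambda>n. 1 - C / (N n * p n) \<le> measure_pmf.prob (?M n) {S. ?good n S}) sequentially"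
    using small \<kappa> corr eventually_gt_at_top[of 0]
  proof eventually_elim
    case (elim n)
    let ?P = "parallelograms (grid n :: (int ^ 'd) set)"
    have card: "real (card (grid n :: (int ^ 'd) set)) = N n"
      by (simp add: card_grid N_def)
    have "real (card ?P) * p n ^ 4 \<le> N n ^ 3 * (1 / 12 + 1 / (24 * (real n)\<^sup>2)) * p n ^ 4"
      using card_parallelograms_grid_le[where 'd = 'd, of n] elim(5) p[of n]
      by (intro mult_right_mono) (auto simp: N_def)
    also have "\<dots> = ((N n)\<^sup>2 * p n ^ 3 / 12 + (N n)\<^sup>2 * p n ^ 3 * (1 / (24 * (real n)\<^sup>2))) * (N n * p n)"
      by (simp add: algebra_simps eval_nat_numeral)
    also have "\<dots> \<le> (\<kappa> + \<epsilon>) * (N n * p n)"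
    proof (rule mult_right_mono)
      have "(N n)\<^sup>2 * p n ^ 3 * (1 / (24 * (real n)\<^sup>2)) \<le> 8 * (1 / (24 * (real n)\<^sup>2))"
        by (rule mult_right_mono) (use elim(2) in auto)
      then show "(N n)\<^sup>2 * p n ^ 3 / 12 + (N n)\<^sup>2 * p n ^ 3 * (1 / (24 * (real n)\<^sup>2)) \<le> \<kappa> + \<epsilon>"
        using elim(3,4) by simp
    qed (use elim(1) in simp)
    finally have P: "real (card ?P) * p n ^ 4 \<le> (\<kappa> + \<epsilon>) * (N n * p n)" .
    let ?B = "{S. \<not> ((1 - 3 * \<epsilon>) * (N n * p n) - real (card ?P) * p n ^ 4 \<le> real (max_sidon S) \<and>
             real (max_sidon S) \<le> (1 + \<epsilon>) * (N n * p n))}"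
    have "measure_pmf.prob (?M n) ?B \<le> C / (N n * p n)"
      using prob_max_sidon_deviates_le[OF tf finite_grid, where q = "p n" and n1 = n] p[of n] elim \<epsilon>
      unfolding card C_def by simp
    then have "1 - C / (N n * p n) \<le> measure_pmf.prob (?M n) (- ?B)"
      using measure_pmf.prob_compl[of ?B "?M n"] by (simp add: Compl_eq_Diff_UNIV)
    also have "\<dots> \<le> measure_pmf.prob (?M n) {S. ?good n S}"
    proof (rule measure_pmf.finite_measure_mono)
      have "\<epsilon> * (N n * p n) \<le> \<eta> * (N n * p n)"
        using elim(1) by (intro mult_right_mono) (auto simp: \<epsilon>_def)
      moreover have "4 * \<epsilon> * (N n * p n) \<le> (\<theta> - \<kappa>) * (N n * p n)"
        using elim(1) by (intro mult_right_mono) (auto simp: \<epsilon>_def min_def)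
      ultimately show "- ?B \<subseteq> {S. ?good n S}"
        using P by (auto simp: algebra_simps)
    qed simp
    finally show ?case .
  qed
  show ?thesis
    unfolding aas_def
  proof (rule tendsto_sandwich[OF low])
    show "eventually (\<lambda>n. measure_pmf.prob (?M n) {S. ?good n S} \<le> 1) sequentially"
      by simp
  qed (use lim in auto)
qed

theorem theorem2p4:
  fixes p :: "nat \<Rightarrow> real"
  assumes "\<And>n. n > 0 \<Longrightarrow> 0 \<le> p n \<and> p n \<le> 1"
  shows
    "((\<lambda>n. real n powr (- real CARD('d::finite))) \<in> o(p) \<and>
       p \<in> o(\<lambda>n. real n powr (- 2 * real CARD('d) / 3)) \<longrightarrow>
       (\<forall>\<eta>>0. aas (\<lambda>n. random_subset (grid n :: (int ^ 'd) set) (p n))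
          (\<lambda>n S. (1 - \<eta>) * (real n ^ CARD('d) * p n) \<le> real (max_sidon S) \<and>
                  real (max_sidon S) \<le> (1 + \<eta>) * (real n ^ CARD('d) * p n)))) \<and>
     ((\<lambda>n. real n powr (- real CARD('d))) \<in> o(p) \<and>
       (\<forall>n>0. p n \<le> 2 * real n powr (- 2 * real CARD('d) / 3)) \<longrightarrow>
       (\<forall>\<eta>>0. aas (\<lambda>n. random_subset (grid n :: (int ^ 'd) set) (p n))
          (\<lambda>n S. (1 / 3 - \<eta>) * (real n ^ CARD('d) * p n) \<le> real (max_sidon S) \<and>
                  real (max_sidon S) \<le> (1 + \<eta>) * (real n ^ CARD('d) * p n))))"
proof -
  let ?N = "\<lambda>n. real n ^ CARD('d)"
  have large: "filterlim (\<lambda>n. ?N n * p n) at_top sequentially"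
    if o: "(\<lambda>n. real n powr (- real CARD('d))) \<in> o(p)"
    unfolding filterlim_at_top_gt[where c = 0]
  proof (intro allI impI)
    fix Z :: real assume Z: "Z > 0"
    show "eventually (\<lambda>n. Z \<le> ?N n * p n) sequentially"
      using landau_o.smallD[OF o zero_less_divide_1_iff[THEN iffD2, OF Z]] eventually_gt_at_top[of 0]
    proof eventually_elim
      case (elim n)
      have "inverse (?N n) \<le> 1 / Z * p n"
        using elim assms[of n] by (simp add: powr_minus powr_realpow)
      then show ?case using Z elim(2) by (simp add: field_simps)
    qed
  qed
  \<comment> \<open>The bound \<open>p \<le> c N\<^bsup>-2/3\<^esup>\<close> says that \<open>N\<^sup>2p\<^sup>3 \<le> c\<^sup>3\<close>, the quantity that controls the
    parallelograms. It is used with \<open>c = 2\<close> and with arbitrarily small \<open>c\<close>.\<close>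
  have cube: "(?N n)\<^sup>2 * p n ^ 3 \<le> c ^ 3"
    if "n > 0" and le: "p n \<le> c * real n powr (- 2 * real CARD('d) / 3)" for n c
  proof -
    have "p n ^ 3 \<le> (c * real n powr (- 2 * real CARD('d) / 3)) ^ 3"
      using le assms[OF \<open>n > 0\<close>] by (intro power_mono) auto
    also have "\<dots> = c ^ 3 * real n powr (- (2 * real CARD('d)))"
      using \<open>n > 0\<close> by (simp add: power_mult_distrib powr_power)
    also have "\<dots> = c ^ 3 / (?N n)\<^sup>2"
      using \<open>n > 0\<close> powr_realpow[of "real n" "2 * CARD('d)"]
      by (simp add: powr_minus divide_inverse power_mult[symmetric] mult.commute)
    finally show ?thesis using \<open>n > 0\<close> by (simp add: field_simps)
  qed
  show ?thesis
  proof (intro conjI impI allI)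
    fix \<eta> :: real
    assume as: "(\<lambda>n. real n powr (- real CARD('d))) \<in> o(p) \<and>
       p \<in> o(\<lambda>n. real n powr (- 2 * real CARD('d) / 3))" and \<eta>: "0 < \<eta>"
    have ev: "eventually (\<lambda>n. (?N n)\<^sup>2 * p n ^ 3 \<le> \<delta>) sequentially" if "0 < \<delta>" for \<delta> :: real
    proof -
      define c where "c = root 3 \<delta>"
      have c: "0 < c" "c ^ 3 = \<delta>" using that by (auto simp: c_def)
      show ?thesis
        using landau_o.smallD[OF conjunct2[OF as] c(1)] eventually_gt_at_top[of 0]
      proof eventually_elim
        case (elim n)
        then show ?case using cube[of n c] c by simp
      qed
    qed
    show "aas (\<lambda>n. random_subset (grid n :: (int ^ 'd) set) (p n))
          (\<lambda>n S. (1 - \<eta>) * (?N n * p n) \<le> real (max_sidon S) \<and>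
                  real (max_sidon S) \<le> (1 + \<eta>) * (?N n * p n))"
      by (rule aas_max_sidon[where \<kappa> = "\<eta> / 2"])
        (use assms large as \<eta> ev[of 8] ev[of "6 * \<eta>"] in \<open>auto simp: field_simps\<close>)
  next
    fix \<eta> :: real
    assume as: "(\<lambda>n. real n powr (- real CARD('d))) \<in> o(p) \<and>
       (\<forall>n>0. p n \<le> 2 * real n powr (- 2 * real CARD('d) / 3))" and \<eta>: "0 < \<eta>"
    have "(?N n)\<^sup>2 * p n ^ 3 \<le> 8" if "n > 0" for n
      using cube[OF that, of 2] as that by simp
    then have ev: "eventually (\<lambda>n. (?N n)\<^sup>2 * p n ^ 3 \<le> 8) sequentially"
      using eventually_gt_at_top[of 0] by (rule eventually_mono[rotated])
    have ev': "eventually (\<lambda>n. (?N n)\<^sup>2 * p n ^ 3 / 12 \<le> 2 / 3) sequentially"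
      by (rule eventually_mono[OF ev]) linarith
    have "1 / 3 - \<eta> = 1 - (2 / 3 + \<eta>)" by simp
    then show "aas (\<lambda>n. random_subset (grid n :: (int ^ 'd) set) (p n))
          (\<lambda>n S. (1 / 3 - \<eta>) * (?N n * p n) \<le> real (max_sidon S) \<and>
                  real (max_sidon S) \<le> (1 + \<eta>) * (?N n * p n))"
      by (simp only:) (rule aas_max_sidon[OF assms large ev ev'], use as \<eta> in auto)
  qed
qed

end
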